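(* Let $r, d_\ell^{\mathrm{in}}, d_\ell^{\mathrm{out}}$ be positive integers, let $A_\ell\in\mathbb{R}^{r\times d_\ell^{\mathrm{in}}}$ and $B_\ell\in\mathbb{R}^{d_\ell^{\mathrm{out}}\times r}$, and let $\alpha:\mathcal{T}\to\mathbb{R}$ be a function on the set of timesteps $\mathcal{T}=\{0,\ldots,T-1\}$. For any timestep $t\in\mathcal{T}$, if $\Delta W_\ell(t)=\frac{\alpha(t)}{r}B_\ell A_\ell$, then $\operatorname{rank}(\Delta W_\ell(t))\leq r$. Moreover, for any input vector $h_{\ell,t}\in\mathbb{R}^{d_\ell^{\mathrm{in}}}$, the vector $\Delta W_\ell(t)h_{\ell,t}$ belongs to $\operatorname{Col}(B_\ell)$.
   Context: $\operatorname{Col}(B)$ denotes the column space of a matrix $B$. The index $\ell$ labels an arbitrary adapted network layer and is fixed; $\alpha(t)$ is a real scaling factor depending on the timestep $t$, while $A_\ell$, $B_\ell$ and $r$ do not depend on $t$. *)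

theory Defs
  imports "Jordan_Normal_Form.DL_Rank"
begin

end

theory Submission
  imports Defs
begin

text \<open>The scalar can be absorbed into \<open>A\<close>, so the update is a product
  \<open>B * C\<close> with \<open>C\<close> of size \<open>r\<close> by \<open>d_in\<close>.
  Whatever such a product outputs is \<open>B\<close> applied to some vector, hence lies in the
  column space of \<open>B\<close> (\<open>mult_mat_vec_in_col_space\<close>). Its own columns lie
  there too, so its rank is at most that of \<open>B\<close> (\<open>rank_mult_le_left\<close>),
  which has only \<open>r\<close> columns.\<close>

lemma (in vec_space) mult_mat_vec_in_col_space:
  assumes "B \<in> carrier_mat n k" and "x \<in> carrier_vec k"
  shows "B *\<^sub>v x \<in> col_space B"
  unfolding col_space_eq[OF assms(1)] using assms by auto

text \<open>Rank is the dimension of the span of the columns, and dimension is monotone for nested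
  finite-dimensional spaces.\<close>

lemma (in vec_space) rank_mono:
  assumes "A \<in> carrier_mat n m" and "B \<in> carrier_mat n k"
    and "set (cols A) \<subseteq> col_space B"
  shows "rank A \<le> rank B"
proof -
  have carrier: "set (cols A) \<subseteq> carrier_vec n" "set (cols B) \<subseteq> carrier_vec n"
    using assms(1,2) cols_dim by fastforce+
  have sub: "span (set (cols A)) \<subseteq> span (set (cols B))"
    using assms(3) carrier(2) span_subsetI unfolding col_space_def by auto
  \<comment> \<open>The larger span becomes the ambient space, because \<open>subspace_dim\<close>
    compares a subspace with the whole space.\<close>
  have "subspace class_ring (span (set (cols A))) (span_vs (set (cols B)))"
    using nested_subspaces[OF span_is_subspace[OF carrier(2)] span_is_subspace[OF carrier(1)] sub] .
  then show ?thesis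
    unfolding rank_def
    using vectorspace.subspace_dim[OF subspace_is_vs[OF span_is_subspace[OF carrier(2)]]]
      fin_dim_span_cols[OF assms(1)] fin_dim_span_cols[OF assms(2)] by auto
qed

text \<open>Column \<open>j\<close> of \<open>B * A\<close> is \<open>B\<close> applied to column
  \<open>j\<close> of \<open>A\<close>, so \<open>rank_mono\<close> applies.\<close>

lemma (in vec_space) rank_mult_le_left:
  assumes B: "B \<in> carrier_mat n k" and A: "A \<in> carrier_mat k m"
  shows "rank (B * A) \<le> rank B"
proof (rule rank_mono)
  show "set (cols (B * A)) \<subseteq> col_space B"
  proof
    fix v assume "v \<in> set (cols (B * A))"
    then obtain j where "j < m" and "v = col (B * A) j"
      using A by (auto simp: cols_def)
    then have "v = B *\<^sub>v col A j"
      using col_mult2[OF B A] by simp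
    then show "v \<in> col_space B"
      using mult_mat_vec_in_col_space[OF B col_carrier_vec[OF \<open>j < m\<close> A]] by simp
  qed
qed (use assms in auto)

theorem proposition4p1:
  fixes r d_in d_out T t :: nat
    and A B :: "real mat"
    and \<alpha> :: "nat \<Rightarrow> real"
    and \<Delta>W :: "nat \<Rightarrow> real mat"
  assumes "r > 0" and "d_in > 0" and "d_out > 0"
    and "A \<in> carrier_mat r d_in"
    and "B \<in> carrier_mat d_out r"
    and "t \<in> {0..<T}"
    and "\<Delta>W t = (\<alpha> t / real r) \<cdot>\<^sub>m (B * A)"
  shows "vec_space.rank d_out (\<Delta>W t) \<le> r
    \<and> (\<forall>h \<in> carrier_vec d_in. \<Delta>W t *\<^sub>v h \<in> vec_space.col_space d_out B)"
proof -
  interpret vec_space "TYPE(real)" d_out .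
  \<comment> \<open>Scaling \<open>A\<close> rather than \<open>B\<close> keeps \<open>B\<close>
    itself as the left factor, so its column space is untouched even if \<open>\<alpha> t\<close> is
    zero.\<close>
  define C where "C = (\<alpha> t / real r) \<cdot>\<^sub>m A"
  have C: "C \<in> carrier_mat r d_in"
    using assms(4) by (simp add: C_def)
  have W: "\<Delta>W t = B * C"
    using assms(4,5,7) by (simp add: C_def mult_smult_distrib)
  have "rank (\<Delta>W t) \<le> r"
    unfolding W using rank_mult_le_left[OF assms(5) C] rank_le_nc[OF assms(5)] by simp
  moreover have "\<Delta>W t *\<^sub>v h \<in> col_space B" if "h \<in> carrier_vec d_in" for h
    unfolding W assoc_mult_mat_vec[OF assms(5) C that]
    using mult_mat_vec_in_col_space[OF assms(5)] C that by simp
  ultimately show ?thesis by blast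
qed

end
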